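(* Let $n$ be a positive integer and let $P_1, P_2 \subseteq \mathbb{Z}_n$ be pitch class sets. Then $P_1$ and $P_2$ are Z-related if and only if $\mu(P_1) = \mu(P_2)$ and the weighted graphs $G(P_1)$ and $G(P_2)$ are not isomorphic.
   Context: Elements of $\mathbb{Z}_n$ are represented by integers in $\{0,\ldots,n-1\}$. A pitch class set is a subset $P \subseteq \mathbb{Z}_n$. The interval class is $\mathrm{ic}(p,q) = \min(|p-q|,\ n-|p-q|)$, computed with these representatives. The interval multiset $\mu(P)$ is the multiset of the $\binom{|P|}{2}$ interval classes $\mathrm{ic}(p,q)$ over all unordered pairs $\{p,q\}$ of distinct elements of $P$. The pitch class graph $G(P)$ is the complete weighted graph with vertex set $P$ in which each such pair $\{p,q\}$ has weight $\mathrm{ic}(p,q)$; an isomorphism of weighted graphs is a bijection of vertex sets preserving all edge weights. The dihedral group $D_n$ acts on $\mathbb{Z}_n$ by transpositions $T_s(p) = p+s$ and inversions $I_s(p) = s-p$ (mod $n$). Two sets are T/I-equivalent if one is the image of the other under some $g \in D_n$. Two sets $P_1, P_2 \subseteq \mathbb{Z}_n$ are Z-related (homometric) if they have the same interval multiset (equivalently, the same interval vector) but are not T/I-equivalent. *)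

theory Defs
  imports Main "HOL-Library.Multiset"
begin

definition pcs :: "int \<Rightarrow> int set" where
  "pcs n = {0..<n}"

definition ic :: "int \<Rightarrow> int \<Rightarrow> int \<Rightarrow> int" where
  "ic n p q = min \<bar>p - q\<bar> (n - \<bar>p - q\<bar>)"

definition unordered_pairs :: "'a set \<Rightarrow> 'a set set" where
  "unordered_pairs P = {e. e \<subseteq> P \<and> card e = 2}"

text \<open>The interval class of an unordered pair, given as a two-element set; see
  \<open>pair_ic_doubleton\<close> below.\<close>

definition pair_ic :: "int \<Rightarrow> int set \<Rightarrow> int" where
  "pair_ic n e = ic n (Min e) (Max e)"

lemma ic_commute: "ic n p q = ic n q p"
  by (simp add: ic_def abs_minus_commute)

lemma pair_ic_doubleton: "pair_ic n {p, q} = ic n p q"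
  by (cases "p \<le> q") (simp_all add: pair_ic_def ic_commute)

definition interval_multiset :: "int \<Rightarrow> int set \<Rightarrow> int multiset" where
  "interval_multiset n P = image_mset (pair_ic n) (mset_set (unordered_pairs P))"

text \<open>Simple undirected graphs with weighted edges; only the values of the weight function on
  the edge set are relevant.\<close>

record ('a, 'w) wgraph =
  verts :: "'a set"
  edges :: "'a set set"
  weight :: "'a set \<Rightarrow> 'w"

definition wgraph_iso :: "('a, 'w) wgraph \<Rightarrow> ('b, 'w) wgraph \<Rightarrow> ('a \<Rightarrow> 'b) \<Rightarrow> bool" where
  "wgraph_iso G H f \<longleftrightarrow>
     bij_betw f (verts G) (verts H) \<and>
     (\<lambda>e. f ` e) ` edges G = edges H \<and>
     (\<forall>e\<in>edges G. weight H (f ` e) = weight G e)"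

definition wgraph_isomorphic :: "('a, 'w) wgraph \<Rightarrow> ('b, 'w) wgraph \<Rightarrow> bool" where
  "wgraph_isomorphic G H \<longleftrightarrow> (\<exists>f. wgraph_iso G H f)"

definition pc_graph :: "int \<Rightarrow> int set \<Rightarrow> (int, int) wgraph" where
  "pc_graph n P = \<lparr>verts = P, edges = unordered_pairs P, weight = pair_ic n\<rparr>"

definition transposition :: "int \<Rightarrow> int \<Rightarrow> int \<Rightarrow> int" where
  "transposition n s p = (p + s) mod n"

definition inversion :: "int \<Rightarrow> int \<Rightarrow> int \<Rightarrow> int" where
  "inversion n s p = (s - p) mod n"

text \<open>The dihedral group enters only through its action, so it is represented by the set of
  maps by which it acts.\<close>

definition dihedral_maps :: "int \<Rightarrow> (int \<Rightarrow> int) set" where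
  "dihedral_maps n = transposition n ` pcs n \<union> inversion n ` pcs n"

definition TI_equivalent :: "int \<Rightarrow> int set \<Rightarrow> int set \<Rightarrow> bool" where
  "TI_equivalent n P Q \<longleftrightarrow> (\<exists>g\<in>dihedral_maps n. g ` P = Q)"

definition Z_related :: "int \<Rightarrow> int set \<Rightarrow> int set \<Rightarrow> bool" where
  "Z_related n P Q \<longleftrightarrow>
     interval_multiset n P = interval_multiset n Q \<and> \<not> TI_equivalent n P Q"

end

theory Submission
  imports Defs
begin

text \<open>Z-relatedness and the right-hand side share the condition on interval multisets, so the
  claim is that T/I-equivalence coincides with isomorphism of pitch class graphs.

  The interval class depends only on the difference of its arguments in \<open>\<int>\<^sub>n\<close>, and determines
  this difference up to sign (\<open>ic_eq_iff_dvd\<close>). Hence isomorphisms of pitch class graphs are the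
  bijections that preserve all differences up to sign, which the elements of the dihedral group
  clearly do. For the converse, the sign might a priori depend on the pair. Fix a base point
  \<open>c\<close>. If some point \<open>a\<close> forced the sign \<open>-1\<close> relative to \<open>c\<close> and another point \<open>b\<close> forced the
  sign \<open>+1\<close>, then the pair \<open>{a, b}\<close> would show that \<open>2 (a - c) = 0\<close> or \<open>2 (b - c) = 0\<close>. But at
  a point with vanishing double difference both signs mean the same, so nothing is forced there.
  Therefore one sign works for all points (\<open>uniform_sign\<close>), and the bijection is the restriction
  of a transposition or of an inversion.\<close>

text \<open>The interval class is the length of the shorter arc between two points on a circle of
  circumference \<open>n\<close>, so its level sets are the pairs \<open>\<plusminus>d\<close> of residues.\<close>

lemma ic_eq_iff_dvd:
  assumes "p \<in> pcs n" "q \<in> pcs n" "r \<in> pcs n" "s \<in> pcs n"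
  shows "ic n p q = ic n r s \<longleftrightarrow> n dvd (p - q) - (r - s) \<or> n dvd (p - q) + (r - s)"
proof -
  have small_dvd: "n dvd z \<longleftrightarrow> z = 0 \<or> z = n \<or> z = - n" if "\<bar>z\<bar> < 2 * n" for z
  proof
    assume "n dvd z"
    then obtain k where k: "z = n * k" by blast
    have "n > 0" using that by linarith
    have "\<bar>k\<bar> < 2"
      using that \<open>n > 0\<close> by (simp add: k abs_mult mult.commute)
    then have "k = 0 \<or> k = 1 \<or> k = - 1" by linarith
    then show "z = 0 \<or> z = n \<or> z = - n" by (auto simp: k)
  qed auto
  define x y where "x = p - q" and "y = r - s"
  have bounds: "\<bar>x\<bar> < n" "\<bar>y\<bar> < n"
    using assms by (auto simp: x_def y_def pcs_def)
  have "ic n p q = ic n r s \<longleftrightarrow> min \<bar>x\<bar> (n - \<bar>x\<bar>) = min \<bar>y\<bar> (n - \<bar>y\<bar>)"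
    by (simp add: ic_def x_def y_def)
  also have "\<dots> \<longleftrightarrow> \<bar>x\<bar> = \<bar>y\<bar> \<or> \<bar>x\<bar> + \<bar>y\<bar> = n"
    by (auto simp: min_def)
  also have "\<dots> \<longleftrightarrow> n dvd x - y \<or> n dvd x + y"
  proof -
    have dvd: "n dvd x - y \<longleftrightarrow> x - y = 0 \<or> x - y = n \<or> x - y = - n"
      "n dvd x + y \<longleftrightarrow> x + y = 0 \<or> x + y = n \<or> x + y = - n"
      using bounds by (intro small_dvd; linarith)+
    from bounds show ?thesis unfolding dvd by (auto simp: abs_if split: if_splits)
  qed
  finally show ?thesis by (simp only: x_def y_def)
qed

text \<open>Isomorphisms can be tested on ordered pairs of vertices: diagonal pairs add nothing, and a
  bijection of vertex sets automatically induces a bijection of the edge sets of complete graphs.\<close>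

lemma wgraph_iso_pc_graph_iff:
  "wgraph_iso (pc_graph n P) (pc_graph n Q) f \<longleftrightarrow>
     bij_betw f P Q \<and> (\<forall>p\<in>P. \<forall>q\<in>P. ic n (f p) (f q) = ic n p q)"
proof (intro iffI conjI)
  assume iso: "wgraph_iso (pc_graph n P) (pc_graph n Q) f"
  then show "bij_betw f P Q" by (simp add: wgraph_iso_def pc_graph_def)
  show "\<forall>p\<in>P. \<forall>q\<in>P. ic n (f p) (f q) = ic n p q"
  proof (intro ballI)
    fix p q assume "p \<in> P" "q \<in> P"
    show "ic n (f p) (f q) = ic n p q"
    proof (cases "p = q")
      case True
      then show ?thesis by (simp add: ic_def)
    next
      case False
      then have "{p, q} \<in> unordered_pairs P"
        using \<open>p \<in> P\<close> \<open>q \<in> P\<close> by (simp add: unordered_pairs_def)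
      then have "pair_ic n (f ` {p, q}) = pair_ic n {p, q}"
        using iso by (simp only: wgraph_iso_def pc_graph_def wgraph.simps)
      then show ?thesis by (simp add: pair_ic_doubleton)
    qed
  qed
next
  assume *: "bij_betw f P Q \<and> (\<forall>p\<in>P. \<forall>q\<in>P. ic n (f p) (f q) = ic n p q)"
  then have inj: "inj_on f P" and im: "f ` P = Q" by (auto simp: bij_betw_def)
  have card: "card (f ` e) = card e" if "e \<subseteq> P" for e
    using inj that by (blast intro: card_image inj_on_subset)
  have "(\<lambda>e. f ` e) ` unordered_pairs P = unordered_pairs Q"
  proof (intro equalityI subsetI)
    fix e assume "e \<in> (\<lambda>e. f ` e) ` unordered_pairs P"
    then show "e \<in> unordered_pairs Q"
      using card im by (auto simp: unordered_pairs_def)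
  next
    fix e assume e: "e \<in> unordered_pairs Q"
    then obtain d where "d \<subseteq> P" "e = f ` d"
      using im by (auto simp: unordered_pairs_def subset_image_iff)
    then show "e \<in> (\<lambda>e. f ` e) ` unordered_pairs P"
      using e card by (auto simp: unordered_pairs_def)
  qed
  moreover have "pair_ic n (f ` e) = pair_ic n e" if e: "e \<in> unordered_pairs P" for e
  proof -
    obtain p q where pq: "e = {p, q}"
      using e by (auto simp: unordered_pairs_def card_2_iff)
    then have "p \<in> P" "q \<in> P" using e by (auto simp: unordered_pairs_def)
    with * show ?thesis by (simp add: pq pair_ic_doubleton)
  qed
  ultimately show "wgraph_iso (pc_graph n P) (pc_graph n Q) f"
    using * by (simp add: wgraph_iso_def pc_graph_def)
qed

lemma dihedral_maps_preserve_ic: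
  assumes "n > 0" "g \<in> dihedral_maps n" "p \<in> pcs n" "q \<in> pcs n"
  shows "ic n (g p) (g q) = ic n p q"
proof -
  have range: "g p \<in> pcs n" "g q \<in> pcs n"
    using assms by (auto simp: dihedral_maps_def transposition_def inversion_def pcs_def)
  have mod_diff: "n dvd (a mod n - b mod n) - (a - b)" for a b
    by (simp add: mod_eq_dvd_iff[symmetric] mod_diff_eq)
  consider s where "g = transposition n s" | s where "g = inversion n s"
    using assms(2) by (auto simp: dihedral_maps_def)
  then have "n dvd (g p - g q) - (p - q) \<or> n dvd (g p - g q) + (p - q)"
  proof cases
    case 1
    then show ?thesis using mod_diff[of "p + s" "q + s"] by (simp add: transposition_def)
  next
    case 2
    then show ?thesis using mod_diff[of "s - p" "s - q"] by (simp add: inversion_def algebra_simps)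
  qed
  then show ?thesis using ic_eq_iff_dvd[OF range assms(3,4)] by blast
qed

lemma dihedral_maps_inj_on:
  assumes "g \<in> dihedral_maps n"
  shows "inj_on g (pcs n)"
proof (rule inj_onI)
  fix p q assume pq: "p \<in> pcs n" "q \<in> pcs n" and "g p = g q"
  then have "n dvd p - q"
    using assms
    by (auto simp: dihedral_maps_def transposition_def inversion_def mod_eq_dvd_iff dvd_diff_commute)
  then show "p = q"
    using pq by (simp add: pcs_def mod_eq_dvd_iff[symmetric])
qed

text \<open>A map that preserves every difference up to a sign, possibly varying with the pair, can be
  given the same sign at all points. This is the rigidity that turns a graph isomorphism into the
  restriction of a single element of the dihedral group.\<close>

lemma uniform_sign:
  fixes n :: int and f :: "int \<Rightarrow> int"
  assumes sign: "\<And>p q. p \<in> P \<Longrightarrow> q \<in> P \<Longrightarrow>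
      n dvd (f p - f q) - (p - q) \<or> n dvd (f p - f q) + (p - q)"
    and "c \<in> P"
  shows "(\<forall>q\<in>P. n dvd (f q - f c) - (q - c)) \<or> (\<forall>q\<in>P. n dvd (f q - f c) + (q - c))"
proof (rule ccontr)
  assume "\<not> ?thesis"
  then obtain a b where "a \<in> P" "b \<in> P"
    and a: "\<not> n dvd (f a - f c) - (a - c)" and b: "\<not> n dvd (f b - f c) + (b - c)"
    by blast
  have a': "n dvd (f a - f c) + (a - c)" using sign[OF \<open>a \<in> P\<close> \<open>c \<in> P\<close>] a by blast
  have b': "n dvd (f b - f c) - (b - c)" using sign[OF \<open>b \<in> P\<close> \<open>c \<in> P\<close>] b by blast
  have ab: "n dvd ((f a - f c) + (a - c)) - ((f b - f c) - (b - c))"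
    using a' b' by (rule dvd_diff)
  from sign[OF \<open>a \<in> P\<close> \<open>b \<in> P\<close>] show False
  proof
    assume "n dvd (f a - f b) - (a - b)"
    from dvd_diff[OF ab this] have "n dvd 2 * (a - c)" by (simp add: algebra_simps)
    from dvd_diff[OF a' this] show False using a by (simp add: algebra_simps)
  next
    assume "n dvd (f a - f b) + (a - b)"
    from dvd_diff[OF ab this] have "n dvd 2 * (b - c)" by (simp add: algebra_simps)
    from dvd_add[OF b' this] show False using b by (simp add: algebra_simps)
  qed
qed

lemma ic_preserving_map_is_dihedral:
  assumes "n > 0" "P \<subseteq> pcs n" "f ` P \<subseteq> pcs n"
    and ic: "\<And>p q. p \<in> P \<Longrightarrow> q \<in> P \<Longrightarrow> ic n (f p) (f q) = ic n p q"
  shows "\<exists>g\<in>dihedral_maps n. \<forall>p\<in>P. f p = g p"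
proof (cases "P = {}")
  case True
  have "transposition n 0 \<in> dihedral_maps n"
    using \<open>n > 0\<close> by (simp add: dihedral_maps_def pcs_def)
  with True show ?thesis by blast
next
  case False
  then obtain c where c: "c \<in> P" by blast
  have sign: "n dvd (f p - f q) - (p - q) \<or> n dvd (f p - f q) + (p - q)"
    if "p \<in> P" "q \<in> P" for p q
    using ic_eq_iff_dvd[of "f p" n "f q" p q] ic[OF that] that assms(2,3) by blast
  have f_mod: "f p = f p mod n" if "p \<in> P" for p
    using that assms(3) by (auto simp: pcs_def)
  from uniform_sign[OF sign c] show ?thesis
  proof
    assume *: "\<forall>q\<in>P. n dvd (f q - f c) - (q - c)"
    define s where "s = (f c - c) mod n"
    have "f p = transposition n s p" if "p \<in> P" for p
    proof -
      have "f p mod n = (p + (f c - c)) mod n"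
        using * that by (simp add: mod_eq_dvd_iff algebra_simps)
      then show ?thesis
        using f_mod[OF that] by (simp add: transposition_def s_def mod_add_right_eq)
    qed
    moreover have "transposition n s \<in> dihedral_maps n"
      using \<open>n > 0\<close> by (simp add: dihedral_maps_def pcs_def s_def)
    ultimately show ?thesis by blast
  next
    assume *: "\<forall>q\<in>P. n dvd (f q - f c) + (q - c)"
    define s where "s = (f c + c) mod n"
    have "f p = inversion n s p" if "p \<in> P" for p
    proof -
      have "f p mod n = ((f c + c) - p) mod n"
        using * that by (simp add: mod_eq_dvd_iff algebra_simps)
      then show ?thesis
        using f_mod[OF that] by (simp add: inversion_def s_def mod_diff_left_eq)
    qed
    moreover have "inversion n s \<in> dihedral_maps n"
      using \<open>n > 0\<close> by (simp add: dihedral_maps_def pcs_def s_def)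
    ultimately show ?thesis by blast
  qed
qed

lemma TI_equivalent_iff_isomorphic:
  assumes "n > 0" "P \<subseteq> pcs n" "Q \<subseteq> pcs n"
  shows "TI_equivalent n P Q \<longleftrightarrow> wgraph_isomorphic (pc_graph n P) (pc_graph n Q)"
proof
  assume "TI_equivalent n P Q"
  then obtain g where g: "g \<in> dihedral_maps n" "g ` P = Q"
    by (auto simp: TI_equivalent_def)
  have "bij_betw g P Q"
    using inj_on_subset[OF dihedral_maps_inj_on[OF g(1)] assms(2)] g(2) by (simp add: bij_betw_def)
  moreover have "\<forall>p\<in>P. \<forall>q\<in>P. ic n (g p) (g q) = ic n p q"
    using dihedral_maps_preserve_ic[OF assms(1) g(1)] assms(2) by blast
  ultimately show "wgraph_isomorphic (pc_graph n P) (pc_graph n Q)"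
    unfolding wgraph_isomorphic_def wgraph_iso_pc_graph_iff by blast
next
  assume "wgraph_isomorphic (pc_graph n P) (pc_graph n Q)"
  then obtain f where f: "f ` P = Q" "\<forall>p\<in>P. \<forall>q\<in>P. ic n (f p) (f q) = ic n p q"
    unfolding wgraph_isomorphic_def wgraph_iso_pc_graph_iff bij_betw_def by blast
  then obtain g where g: "g \<in> dihedral_maps n" "\<forall>p\<in>P. f p = g p"
    using ic_preserving_map_is_dihedral[OF assms(1,2), of f] assms(3) by blast
  then have "g ` P = Q" using f(1) by (simp cong: image_cong)
  with g(1) show "TI_equivalent n P Q" by (auto simp: TI_equivalent_def)
qed

theorem proposition2p2:
  fixes n :: int and P1 P2 :: "int set"
  assumes "n > 0" and "P1 \<subseteq> pcs n" and "P2 \<subseteq> pcs n"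
  shows "Z_related n P1 P2 \<longleftrightarrow>
    interval_multiset n P1 = interval_multiset n P2 \<and>
    \<not> wgraph_isomorphic (pc_graph n P1) (pc_graph n P2)"
  using TI_equivalent_iff_isomorphic[OF assms] by (simp add: Z_related_def)

end
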